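(* Let $X_\omega$ be the second Laakso space with metric $d$, let $u$ and $v$ be the two vertices of $X_0\subset X_\omega$, and call marked every geodesic joining $u$ and $v$ in any of the spaces $X_i$, $i=0,1,2,\dots$ (regarded as a geodesic in the completion of $X_\omega$). Then the following two conditions hold. (1) There are infinitely many marked $uv$-geodesics. (2) There is a constant $c>0$ (not depending on $u_0,v_0$) such that for any two points $u_0$ and $v_0$ lying on a marked $uv$-geodesic there are $n\in\mathbb N$ and points $w_0=u_0,w_1,\dots,w_{n-1},w_n=v_0$ which also lie on some marked $uv$-geodesic, their order on that geodesic coinciding with the order in which they are listed, and points $z_1,\dots,z_n,\widetilde z_1,\dots,\widetilde z_n$ such that: (a) the points $w_0=u_0,z_1,w_1,z_2,\dots,w_{n-1},z_n,w_n=v_0$ lie on a marked $uv$-geodesic and are listed in their order on this geodesic; (b) the points $w_0=u_0,\widetilde z_1,w_1,\widetilde z_2,\dots,w_{n-1},\widetilde z_n,w_n=v_0$ lie on a marked $uv$-geodesic and are listed in their order on this geodesic; (c) $d(w_i,z_i)=d(w_i,\widetilde z_i)$ and $d(w_{i-1},z_i)=d(w_{i-1},\widetilde z_i)$ for $i=1,\dots,n$; (d) $\sum_{i=1}^n d(z_i,\widetilde z_i)\ge c\,d(u_0,v_0)$.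
   Context: Second Laakso space $X_\omega$. It is an increasing union of graph thickenings, i.e. metric graphs in which each edge is isometric to a line segment of the corresponding length and all points of the edges belong to the space. $X_0$ consists of two vertices and an edge of length $1$ joining them. Given $X_i$, the space $X_{i+1}$ is constructed in two steps. Step 1. Replace each edge of $X_i$ by a path of the same total length consisting of three edges of equal length (i.e. trisect each edge by inserting two new vertices). Let $N_i$ be the set of all new vertices so inserted (the old vertices of $X_i$ are not in $N_i$), and let $X_i'$ be the resulting graph (the same metric space as $X_i$, with more vertices). Step 2. Take two copies of $X_i'$ and paste them together at the corresponding points of $N_i$: $X_{i+1}$ is the set of equivalence classes of $X_i'\times\{0,1\}$ under the relation $(x,0)\sim(x,1)$ for all $x\in N_i$ (all other classes are singletons), with its shortest path distance. Identifying $X_i$ with $X_i\times\{0\}$ gives an isometric embedding $X_i\to X_{i+1}$. $X_\omega=\bigcup_i X_i$ with $d(x,y)=d_{X_i}(x,y)$ for any $i$ large enough that $x,y\in X_i$. A geodesic between $u$ and $v$ is (the image of) an isometric embedding $\gamma$ of $[0,d(u,v)]$ with $\gamma(0)=u$, $\gamma(d(u,v))=v$. The order of points on it is the order in which they are met when travelling along the geodesic (in the direction from $u_0$ to $v_0$). *)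

theory Defs
  imports "HOL-Analysis.Analysis"
begin

section \<open>Graph thickenings\<close>

text \<open>
  A graph thickening all of whose edges have length \<open>l\<close> is given by a set \<open>E\<close> of parametrised edges:
  \<open>e \<in> E\<close> maps \<open>{0..l}\<close> onto the edge, with end vertices \<open>e 0\<close> and \<open>e l\<close>; the values of \<open>e\<close>
  outside \<open>{0..l}\<close> are irrelevant. Parallel edges are allowed.
\<close>

definition thickening :: "real \<Rightarrow> (real \<Rightarrow> 'p) set \<Rightarrow> 'p set" where
  "thickening l E = (\<Union>e\<in>E. e ` {0..l})"

text \<open>
  \<open>path_of_length l E x y r\<close>: there is a path of length \<open>r\<close> from \<open>x\<close> to \<open>y\<close> which is a finite
  concatenation of segments, each contained in one edge.
\<close>

inductive path_of_length :: "real \<Rightarrow> (real \<Rightarrow> 'p) set \<Rightarrow> 'p \<Rightarrow> 'p \<Rightarrow> real \<Rightarrow> bool"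
  for l :: real and E :: "(real \<Rightarrow> 'p) set" where
  trivial: "path_of_length l E x x 0"
| segment: "e \<in> E \<Longrightarrow> s \<in> {0..l} \<Longrightarrow> t \<in> {0..l} \<Longrightarrow> path_of_length l E (e t) y r
    \<Longrightarrow> path_of_length l E (e s) y (\<bar>s - t\<bar> + r)"

definition path_dist :: "real \<Rightarrow> (real \<Rightarrow> 'p) set \<Rightarrow> 'p \<Rightarrow> 'p \<Rightarrow> real" where
  "path_dist l E x y = Inf {r. path_of_length l E x y r}"

definition trisect :: "real \<Rightarrow> (real \<Rightarrow> 'p) set \<Rightarrow> (real \<Rightarrow> 'p) set" where
  "trisect l E = {(\<lambda>s. e (real k * (l / 3) + s)) | e k. e \<in> E \<and> k < 3}"

definition new_vertices :: "real \<Rightarrow> (real \<Rightarrow> 'p) set \<Rightarrow> 'p set" where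
  "new_vertices l E = (\<Union>e\<in>E. {e (l / 3), e (2 * (l / 3))})"


section \<open>The second Laakso space\<close>

text \<open>
  \<open>Base t\<close> is the point \<open>t\<close> of \<open>X\<^sub>0 = {0..1}\<close>. The class of \<open>(x, 0)\<close> in \<open>X\<^sub>i\<^sub>+\<^sub>1\<close> is identified
  with \<open>x\<close>, and the class of \<open>(x, 1)\<close> for \<open>x \<notin> N\<^sub>i\<close> is \<open>Second i x\<close>. Hence \<open>X\<^sub>i \<subseteq> X\<^sub>i\<^sub>+\<^sub>1\<close>.
\<close>

datatype laakso_point = Base real | Second nat laakso_point

text \<open>\<open>paste i N b x\<close> is the class of \<open>(x, b)\<close> in \<open>X\<^sub>i\<^sub>+\<^sub>1\<close>, where \<open>N = N\<^sub>i\<close>.\<close>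

definition paste :: "nat \<Rightarrow> laakso_point set \<Rightarrow> bool \<Rightarrow> laakso_point \<Rightarrow> laakso_point" where
  "paste i N b x = (if b \<and> x \<notin> N then Second i x else x)"

definition laakso_len :: "nat \<Rightarrow> real" where
  "laakso_len i = 1 / 3 ^ i"

primrec laakso_edges :: "nat \<Rightarrow> (real \<Rightarrow> laakso_point) set" where
  "laakso_edges 0 = {Base}"
| "laakso_edges (Suc i) =
     {paste i (new_vertices (laakso_len i) (laakso_edges i)) b \<circ> e | b e.
        e \<in> trisect (laakso_len i) (laakso_edges i)}"

definition laakso_stage :: "nat \<Rightarrow> laakso_point set" where
  "laakso_stage i = thickening (laakso_len i) (laakso_edges i)"

definition stage_dist :: "nat \<Rightarrow> laakso_point \<Rightarrow> laakso_point \<Rightarrow> real" where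
  "stage_dist i = path_dist (laakso_len i) (laakso_edges i)"

definition laakso :: "laakso_point set" where
  "laakso = (\<Union>i. laakso_stage i)"

text \<open>
  Since the inclusions \<open>X\<^sub>i \<subseteq> X\<^sub>i\<^sub>+\<^sub>1\<close> are isometric, any stage containing both points gives the
  same value; we use the first one.
\<close>

definition laakso_dist :: "laakso_point \<Rightarrow> laakso_point \<Rightarrow> real" where
  "laakso_dist x y = stage_dist (LEAST i. x \<in> laakso_stage i \<and> y \<in> laakso_stage i) x y"


section \<open>Geodesics\<close>

definition geodesic ::
    "'p set \<Rightarrow> ('p \<Rightarrow> 'p \<Rightarrow> real) \<Rightarrow> 'p \<Rightarrow> 'p \<Rightarrow> (real \<Rightarrow> 'p) \<Rightarrow> bool" where
  "geodesic M d a b \<gamma> \<longleftrightarrow>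
     \<gamma> ` {0..d a b} \<subseteq> M \<and> \<gamma> 0 = a \<and> \<gamma> (d a b) = b \<and>
     (\<forall>s\<in>{0..d a b}. \<forall>t\<in>{0..d a b}. d (\<gamma> s) (\<gamma> t) = \<bar>s - t\<bar>)"

text \<open>
  \<open>G\<close> is the image of a geodesic between \<open>a\<close> and \<open>b\<close>, and the points of the list \<open>ps\<close> (repetitions
  allowed) are met in this order when \<open>G\<close> is travelled along in the direction from \<open>hd ps\<close> to
  \<open>last ps\<close>, which may be the direction from \<open>a\<close> to \<open>b\<close> or the opposite one.
\<close>

definition listed_in_order ::
    "'p set \<Rightarrow> ('p \<Rightarrow> 'p \<Rightarrow> real) \<Rightarrow> 'p \<Rightarrow> 'p \<Rightarrow> 'p set \<Rightarrow> 'p list \<Rightarrow> bool" where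
  "listed_in_order M d a b G ps \<longleftrightarrow>
     (\<exists>\<gamma> ts. geodesic M d a b \<gamma> \<and> G = \<gamma> ` {0..d a b} \<and>
        set ts \<subseteq> {0..d a b} \<and> (sorted ts \<or> sorted (rev ts)) \<and> ps = map \<gamma> ts)"

text \<open>The list \<open>w\<^sub>0, z\<^sub>1, w\<^sub>1, z\<^sub>2, \<dots>, w\<^sub>n\<^sub>-\<^sub>1, z\<^sub>n, w\<^sub>n\<close>.\<close>

definition interleave :: "nat \<Rightarrow> (nat \<Rightarrow> 'p) \<Rightarrow> (nat \<Rightarrow> 'p) \<Rightarrow> 'p list" where
  "interleave n w z = w 0 # concat (map (\<lambda>i. [z i, w i]) [1..<Suc n])"


section \<open>Completion and marked geodesics\<close>

definition is_completion ::
    "'p set \<Rightarrow> ('p \<Rightarrow> 'p \<Rightarrow> real) \<Rightarrow> 'c set \<Rightarrow> ('c \<Rightarrow> 'c \<Rightarrow> real) \<Rightarrow> ('p \<Rightarrow> 'c) \<Rightarrow> bool" where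
  "is_completion X d M dM \<iota> \<longleftrightarrow>
     Metric_space M dM \<and> Metric_space.mcomplete M dM \<and> \<iota> ` X \<subseteq> M \<and>
     (\<forall>x\<in>X. \<forall>y\<in>X. dM (\<iota> x) (\<iota> y) = d x y) \<and>
     Metric_space.mtopology M dM closure_of (\<iota> ` X) = M"

text \<open>Images in the completion, under \<open>\<iota>\<close>, of the geodesics between \<open>u\<close> and \<open>v\<close> in the \<open>X\<^sub>i\<close>.\<close>

definition marked_geodesics :: "(laakso_point \<Rightarrow> 'c) \<Rightarrow> 'c set set" where
  "marked_geodesics \<iota> =
     {\<iota> ` \<gamma> ` {0..stage_dist i (Base 0) (Base 1)} | \<gamma> i.
        geodesic (laakso_stage i) (stage_dist i) (Base 0) (Base 1) \<gamma>}"

end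

theory Submission
  imports Defs
begin

text \<open>
  A point of the space is a height in \<open>{0..1}\<close> together with one binary coordinate for each pasting
  step, and a curve between the base vertices is geodesic iff it is monotone in height. Given a
  marked geodesic in \<open>X\<^sub>j\<close>, switching its \<open>j\<close>-th coordinate on some of the middle thirds of the
  intervals of length \<open>1 / 3\<^sup>j\<close> yields another one, because the ends of these thirds are pasted; the
  midpoints of a switched third are \<open>1 / 3\<^sup>j\<^sup>+\<^sup>1\<close> apart, since any path between them passes through a
  pasted point. Switching for \<open>j\<close> large all middle thirds of those intervals that lie between the
  heights of \<open>u\<^sub>0\<close> and \<open>v\<^sub>0\<close> gives the second condition, with \<open>c = 1 / 6\<close>.
\<close>


section \<open>Paths in graph thickenings\<close>

lemma path_of_length_nonneg: "path_of_length l E x y r \<Longrightarrow> 0 \<le> r"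
  by (induction rule: path_of_length.induct) auto

lemma path_of_length_trans:
  assumes "path_of_length l E x y r" "path_of_length l E y z q"
  shows "path_of_length l E x z (r + q)"
  using assms
proof (induction rule: path_of_length.induct)
  case (segment e s t y r)
  then show ?case
    using path_of_length.segment[of e E s l t z "r + q"] by (simp add: add.assoc)
qed simp

lemma path_of_length_edge:
  assumes "e \<in> E" "s \<in> {0..l}" "t \<in> {0..l}"
  shows "path_of_length l E (e s) (e t) \<bar>s - t\<bar>"
  using path_of_length.segment[OF assms path_of_length.trivial] by simp

lemma path_of_length_sym: "path_of_length l E x y r \<Longrightarrow> path_of_length l E y x r"
proof (induction rule: path_of_length.induct)
  case (segment e s t y r)
  then show ?case
    using path_of_length_trans[OF segment.IH path_of_length_edge[of e E t l s]]
    by (simp add: add.commute abs_minus_commute)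
qed (rule path_of_length.trivial)

text \<open>Shifting the parameter does not change the length of a segment. The shift
  \<open>c\<close> lets an edge be mapped onto a part of a longer edge, as happens when a stage is
  projected to the preceding one.\<close>

lemma path_of_length_map:
  assumes "\<And>e. e \<in> E \<Longrightarrow> \<exists>e'\<in>E'. \<exists>c. \<forall>s\<in>{0..l}. s + c \<in> {0..l'} \<and> f (e s) = e' (s + c)"
    and "path_of_length l E x y r"
  shows "path_of_length l' E' (f x) (f y) r"
  using assms(2)
proof (induction rule: path_of_length.induct)
  case (segment e s t y r)
  obtain e' c where e': "e' \<in> E'"
    and c: "\<And>s. s \<in> {0..l} \<Longrightarrow> s + c \<in> {0..l'} \<and> f (e s) = e' (s + c)"
    using assms(1)[OF segment.hyps(1)] by blast
  show ?case
    using path_of_length.segment[OF e', of "s + c" l' "t + c" "f y" r] segment c by simp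
qed (rule path_of_length.trivial)

text \<open>Triangle inequality over the segments. The lower bounds on distances by heights and by
  copies of a pasting come from here.\<close>

lemma path_of_length_lipschitz:
  fixes \<phi> :: "'p \<Rightarrow> real"
  assumes "\<And>e s t. e \<in> E \<Longrightarrow> \<bar>\<phi> (e s) - \<phi> (e t)\<bar> \<le> \<bar>s - t\<bar>"
    and "path_of_length l E x y r"
  shows "\<bar>\<phi> x - \<phi> y\<bar> \<le> r"
  using assms(2)
proof (induction rule: path_of_length.induct)
  case (segment e s t y r)
  then show ?case using assms(1)[of e s t] by linarith
qed simp

lemma path_of_length_trisect_edge:
  assumes l: "0 \<le> l" and e: "e \<in> E" and st: "0 \<le> s" "s \<le> t" "t \<le> l"
  shows "path_of_length (l / 3) (trisect l E) (e s) (e t) (t - s)"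
proof -
  \<comment> \<open>The alternative \<open>p = q\<close> admits degenerate pieces, which need not
    lie in the third with number \<open>k\<close>.\<close>
  have third: "path_of_length (l / 3) (trisect l E) (e p) (e q) (q - p)"
    if "p = q \<or> real k * (l / 3) \<le> p \<and> p \<le> q \<and> q \<le> real k * (l / 3) + l / 3" "k < 3" for p q k
  proof (cases "p = q")
    case True
    then show ?thesis by (simp add: path_of_length.trivial)
  next
    case False
    have "(\<lambda>s. e (real k * (l / 3) + s)) \<in> trisect l E"
      using e that(2) unfolding trisect_def by blast
    from path_of_length_edge[OF this, of "p - real k * (l / 3)" "l / 3" "q - real k * (l / 3)"]
    show ?thesis using that False by (simp add: abs_if)
  qed
  \<comment> \<open>The cut points \<open>l / 3\<close> and \<open>2 * l / 3\<close>, moved into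
    \<open>{s..t}\<close>: each of the three pieces then lies in one third or is a single
    point.\<close>
  define p where "p = max s (min t (l / 3))"
  define q where "q = max s (min t (2 * l / 3))"
  have "path_of_length (l / 3) (trisect l E) (e s) (e p) (p - s)"
    using st l by (intro third[where k = 0]) (auto simp: p_def)
  moreover have "path_of_length (l / 3) (trisect l E) (e p) (e q) (q - p)"
    using st l by (intro third[where k = 1]) (auto simp: p_def q_def)
  moreover have "path_of_length (l / 3) (trisect l E) (e q) (e t) (t - q)"
    using st l by (intro third[where k = 2]) (auto simp: q_def)
  ultimately have "path_of_length (l / 3) (trisect l E) (e s) (e t) ((p - s) + ((q - p) + (t - q)))"
    by (blast intro: path_of_length_trans)
  then show ?thesis by simp
qed

lemma path_of_length_trisect:
  assumes "0 \<le> l" "path_of_length l E x y r"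
  shows "path_of_length (l / 3) (trisect l E) x y r"
  using assms(2)
proof (induction rule: path_of_length.induct)
  case (segment e s t y r)
  have "path_of_length (l / 3) (trisect l E) (e s) (e t) \<bar>s - t\<bar>"
  proof (cases "s \<le> t")
    case True
    then show ?thesis
      using path_of_length_trisect_edge[OF assms(1) segment.hyps(1), of s t] segment.hyps
      by (simp add: abs_of_nonpos)
  next
    case False
    then show ?thesis
      using path_of_length_sym[OF path_of_length_trisect_edge[OF assms(1) segment.hyps(1), of t s]]
        segment.hyps by (simp add: abs_of_nonneg)
  qed
  then show ?case using segment.IH by (rule path_of_length_trans)
qed (rule path_of_length.trivial)

text \<open>A larger set of lengths has a smaller infimum. The first assumption makes the smaller
  set nonempty, as \<open>Inf {}\<close> has no meaningful value.\<close>

lemma path_dist_mono: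
  assumes "path_of_length l E x y r"
    and "\<And>r. path_of_length l E x y r \<Longrightarrow> path_of_length l' E' x' y' r"
  shows "path_dist l' E' x' y' \<le> path_dist l E x y"
  unfolding path_dist_def
proof (rule cInf_superset_mono)
  show "bdd_below {r. path_of_length l' E' x' y' r}"
    by (rule bdd_belowI[of _ 0]) (simp add: path_of_length_nonneg)
qed (use assms in auto)


section \<open>Heights and coordinates in the Laakso stages\<close>

primrec height :: "laakso_point \<Rightarrow> real" where
  "height (Base t) = t"
| "height (Second i x) = height x"

text \<open>The binary coordinate of the \<open>j\<close>-th pasting. Pasted points belong to both
  copies and count as points of the first one.\<close>

primrec has_second :: "nat \<Rightarrow> laakso_point \<Rightarrow> bool" where
  "has_second j (Base t) \<longleftrightarrow> False"
| "has_second j (Second i x) \<longleftrightarrow> i = j \<or> has_second j x"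

text \<open>Contains the heights of all vertices present after the trisection of stage
  \<open>j\<close>, both the pasted new ones and the old ones.\<close>

definition grid :: "nat \<Rightarrow> real set" where
  "grid j = range (\<lambda>m::int. of_int m / 3 ^ Suc j)"

lemma laakso_len_Suc: "laakso_len (Suc i) = laakso_len i / 3"
  by (simp add: laakso_len_def)

lemma laakso_len_pos: "0 < laakso_len i"
  by (simp add: laakso_len_def)

lemma height_paste [simp]: "height (paste i N b x) = height x"
  by (simp add: paste_def)

lemma laakso_edges_SucE:
  assumes "e \<in> laakso_edges (Suc i)"
  obtains b e' k where "e' \<in> laakso_edges i" "k < 3"
    "e = paste i (new_vertices (laakso_len i) (laakso_edges i)) b \<circ>
         (\<lambda>s. e' (real k * (laakso_len i / 3) + s))"
  using assms by (auto simp: trisect_def)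

lemma laakso_edges_SucI:
  assumes "e \<in> laakso_edges i" "k < 3"
  shows "paste i (new_vertices (laakso_len i) (laakso_edges i)) b \<circ>
         (\<lambda>s. e (real k * (laakso_len i / 3) + s)) \<in> laakso_edges (Suc i)"
  using assms by (auto simp: trisect_def)

declare laakso_edges.simps(2) [simp del]

text \<open>Trisection shifts the parameter and \<open>paste\<close> keeps the height, so every edge
  runs upwards at unit speed. The formula holds for all real \<open>s\<close>, also outside the
  edge.\<close>

lemma height_edge: "e \<in> laakso_edges i \<Longrightarrow> \<exists>m::nat. \<forall>s. height (e s) = real m * laakso_len i + s"
proof (induction i arbitrary: e)
  case (Suc i)
  obtain b e' k where e': "e' \<in> laakso_edges i" and e: "e = paste i
      (new_vertices (laakso_len i) (laakso_edges i)) b \<circ> (\<lambda>s. e' (real k * (laakso_len i / 3) + s))"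
    using Suc.prems by (rule laakso_edges_SucE)
  obtain m :: nat where "\<forall>s. height (e' s) = real m * laakso_len i + s"
    using Suc.IH[OF e'] by blast
  then have "\<forall>s. height (e s) = real (3 * m + k) * laakso_len (Suc i) + s"
    by (simp add: e laakso_len_Suc algebra_simps)
  then show ?case by blast
qed simp

lemma has_second_edge: "e \<in> laakso_edges i \<Longrightarrow> has_second j (e s) \<Longrightarrow> j < i"
proof (induction i arbitrary: e s)
  case (Suc i)
  obtain b e' k where e': "e' \<in> laakso_edges i" and e: "e = paste i
      (new_vertices (laakso_len i) (laakso_edges i)) b \<circ> (\<lambda>s. e' (real k * (laakso_len i / 3) + s))"
    using Suc.prems(1) by (rule laakso_edges_SucE)
  show ?case
    using Suc.IH[OF e'] Suc.prems(2) by (fastforce simp: e paste_def less_Suc_eq split: if_splits)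
qed simp

lemma height_new_vertices:
  assumes "x \<in> new_vertices (laakso_len i) (laakso_edges i)"
  shows "height x \<in> grid i"
proof -
  obtain e where e: "e \<in> laakso_edges i"
    and x: "x = e (laakso_len i / 3) \<or> x = e (2 * (laakso_len i / 3))"
    using assms by (auto simp: new_vertices_def)
  obtain m :: nat where m: "\<forall>s. height (e s) = real m * laakso_len i + s"
    using height_edge[OF e] by blast
  from x show ?thesis
  proof
    assume "x = e (laakso_len i / 3)"
    then have "height x = of_int (3 * int m + 1) / 3 ^ Suc i"
      using m[THEN spec, of "laakso_len i / 3"] by (simp add: laakso_len_def add_divide_distrib)
    then show ?thesis unfolding grid_def by blast
  next
    assume "x = e (2 * (laakso_len i / 3))"
    then have "height x = of_int (3 * int m + 2) / 3 ^ Suc i"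
      using m[THEN spec, of "2 * (laakso_len i / 3)"] by (simp add: laakso_len_def add_divide_distrib)
    then show ?thesis unfolding grid_def by blast
  qed
qed

text \<open>The \<open>j\<close>-th pasting puts an edge into one copy, except for its pasted
  points, whose heights are in the grid; the other pastings change neither this coordinate nor the
  height.\<close>

lemma has_second_edge_const:
  "e \<in> laakso_edges i \<Longrightarrow> \<exists>b. \<forall>s. has_second j (e s) \<noteq> b \<longrightarrow> height (e s) \<in> grid j"
proof (induction i arbitrary: e)
  case (Suc i)
  obtain b e' k where e': "e' \<in> laakso_edges i" and e: "e = paste i
      (new_vertices (laakso_len i) (laakso_edges i)) b \<circ> (\<lambda>s. e' (real k * (laakso_len i / 3) + s))"
    using Suc.prems by (rule laakso_edges_SucE)
  show ?case
  proof (cases "j = i")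
    case True
    have "\<forall>s. \<not> has_second i (e' s)"
      using has_second_edge[OF e'] by blast
    then have "\<forall>s. has_second j (e s) \<noteq> b \<longrightarrow> height (e s) \<in> grid j"
      using True by (auto simp: e paste_def height_new_vertices)
    then show ?thesis by blast
  next
    case False
    obtain b' where "\<forall>s. has_second j (e' s) \<noteq> b' \<longrightarrow> height (e' s) \<in> grid j"
      using Suc.IH[OF e'] by blast
    then have "\<forall>s. has_second j (e s) \<noteq> b' \<longrightarrow> height (e s) \<in> grid j"
      using False by (auto simp: e paste_def)
    then show ?thesis by blast
  qed
qed auto

text \<open>Uniform in the stage, because \<open>laakso_dist\<close> is computed in a stage that is
  not known explicitly.\<close>

definition edge_lipschitz :: "(laakso_point \<Rightarrow> real) \<Rightarrow> bool" where
  "edge_lipschitz \<phi> \<longleftrightarrow> (\<forall>i. \<forall>e\<in>laakso_edges i. \<forall>s t. \<bar>\<phi> (e s) - \<phi> (e t)\<bar> \<le> \<bar>s - t\<bar>)"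

lemma edge_lipschitz_height: "edge_lipschitz height"
  unfolding edge_lipschitz_def using height_edge by fastforce

text \<open>
  A path switching between the two copies of the \<open>j\<close>-th pasting must pass through a point with
  height in \<open>grid j\<close>, where this function vanishes; so it is Lipschitz despite the sign change.
\<close>

definition copy_height :: "nat \<Rightarrow> laakso_point \<Rightarrow> real" where
  "copy_height j x = (if has_second j x then 1 else -1) * infdist (height x) (grid j)"

lemma edge_lipschitz_copy_height: "edge_lipschitz (copy_height j)"
  unfolding edge_lipschitz_def
proof (intro allI ballI)
  fix i e s t
  assume e: "e \<in> laakso_edges i"
  obtain b where b: "\<And>s. has_second j (e s) \<noteq> b \<Longrightarrow> height (e s) \<in> grid j"
    using has_second_edge_const[OF e, of j] by blast
  define \<sigma> :: real where "\<sigma> = (if b then 1 else -1)"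
  \<comment> \<open>Where the coordinate differs from \<open>b\<close>, the distance to the grid is
    0 and the sign does not matter.\<close>
  have \<phi>: "copy_height j (e s) = \<sigma> * infdist (height (e s)) (grid j)" for s
    using b[of s] by (auto simp: copy_height_def \<sigma>_def)
  obtain m :: nat where m: "\<And>s. height (e s) = real m * laakso_len i + s"
    using height_edge[OF e] by blast
  have "\<bar>copy_height j (e s) - copy_height j (e t)\<bar>
      = \<bar>infdist (height (e s)) (grid j) - infdist (height (e t)) (grid j)\<bar>"
    by (auto simp: \<phi> \<sigma>_def)
  also have "\<dots> \<le> dist (height (e s)) (height (e t))"
    by (rule infdist_triangle_abs)
  also have "\<dots> = \<bar>s - t\<bar>"
    by (simp add: m dist_real_def)
  finally show "\<bar>copy_height j (e s) - copy_height j (e t)\<bar> \<le> \<bar>s - t\<bar>" .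
qed


section \<open>Maps between the stages\<close>

text \<open>The middle thirds of the intervals of length \<open>1 / 3 ^ j\<close> with numbers in
  \<open>A\<close>; open, because their ends are heights of pasted points.\<close>

definition middle :: "nat \<Rightarrow> nat set \<Rightarrow> real set" where
  "middle j A = (\<Union>m\<in>A. {(3 * real m + 1) / 3 ^ Suc j <..< (3 * real m + 2) / 3 ^ Suc j})"

text \<open>Meant for points of stage \<open>j\<close>, which are all in the first copy of the
  \<open>j\<close>-th pasting. For \<open>A = {}\<close> this is the inclusion into the next stage,
  so facts about \<open>flip\<close> also cover the inclusion.\<close>

definition flip :: "nat \<Rightarrow> nat set \<Rightarrow> laakso_point \<Rightarrow> laakso_point" where
  "flip j A x = (if height x \<in> middle j A then Second j x else x)"

lemma height_flip [simp]: "height (flip j A x) = height x"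
  by (simp add: flip_def)

lemma flip_empty [simp]: "flip j {} x = x"
  by (simp add: flip_def middle_def)

lemma middle_iff:
  "t \<in> middle j A \<longleftrightarrow> (\<exists>m\<in>A. 3 * real m + 1 < t * 3 ^ Suc j \<and> t * 3 ^ Suc j < 3 * real m + 2)"
  by (simp add: middle_def field_simps)

lemma middle_grid_disjoint: "t \<in> middle j A \<Longrightarrow> t \<notin> grid j"
proof
  assume "t \<in> middle j A" "t \<in> grid j"
  then obtain m :: nat and k :: int where
    "3 * real m + 1 < t * 3 ^ Suc j" "t * 3 ^ Suc j < 3 * real m + 2" "t = of_int k / 3 ^ Suc j"
    unfolding middle_iff grid_def by blast
  then have "3 * real m + 1 < of_int k" "of_int k < 3 * real m + 2"
    by simp_all
  then have "3 * int m + 1 < k \<and> k < 3 * int m + 2" by linarith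
  then show False by presburger
qed

text \<open>In units of \<open>1 / 3 ^ Suc j\<close> the number is a multiple of three. Hence
  \<open>flip\<close> fixes the two base vertices.\<close>

lemma multiple_notin_middle: "real i / 3 ^ j \<notin> middle j A"
proof
  assume "real i / 3 ^ j \<in> middle j A"
  then obtain m :: nat where "3 * real m + 1 < 3 * real i" "3 * real i < 3 * real m + 2"
    by (auto simp: middle_iff field_simps)
  then have "3 * m + 1 < 3 * i \<and> 3 * i < 3 * m + 2" by linarith
  then show False by presburger
qed

text \<open>Each third of an edge goes as a whole into one copy, and at the ends of a switched third
  the two copies agree.\<close>

lemma flip_edge:
  assumes e: "e \<in> laakso_edges j" and k: "k < 3"
  shows "\<exists>e'\<in>laakso_edges (Suc j). \<forall>s\<in>{0..laakso_len j / 3}.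
    flip j A (e (real k * (laakso_len j / 3) + s)) = e' s"
proof -
  let ?N = "new_vertices (laakso_len j) (laakso_edges j)"
  obtain m :: nat where m: "\<And>s. height (e s) = real m * laakso_len j + s"
    using height_edge[OF e] by blast
  \<comment> \<open>The second copy is used exactly for the middle third of an edge whose interval
    is in \<open>A\<close>.\<close>
  define b where "b \<longleftrightarrow> k = 1 \<and> m \<in> A"
  have "flip j A (e (real k * (laakso_len j / 3) + s))
      = paste j ?N b (e (real k * (laakso_len j / 3) + s))"
    if s: "s \<in> {0..laakso_len j / 3}" for s
  proof -
    define x where "x = e (real k * (laakso_len j / 3) + s)"
    \<comment> \<open>The position within the third, rescaled to \<open>{0..1}\<close>; in these
      units the thirds begin at integer heights.\<close>
    define \<sigma> where "\<sigma> = s * 3 ^ Suc j"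
    have \<sigma>: "0 \<le> \<sigma>" "\<sigma> \<le> 1"
      using s by (auto simp: \<sigma>_def laakso_len_def field_simps)
    have hx: "height x * 3 ^ Suc j = 3 * real m + real k + \<sigma>"
      by (simp add: x_def m \<sigma>_def laakso_len_def field_simps)
    show ?thesis
    proof (cases "height x \<in> middle j A")
      case True
      then obtain m' where m': "m' \<in> A" "3 * real m' + 1 < 3 * real m + real k + \<sigma>"
        "3 * real m + real k + \<sigma> < 3 * real m' + 2"
        unfolding middle_iff hx by blast
      then have "3 * real m' < 3 * real m + real k" "3 * real m + real k < 3 * real m' + 2"
        using \<sigma> by linarith+
      then have "3 * m' < 3 * m + k" "3 * m + k < 3 * m' + 2"
        by linarith+
      then have "k = 1" "m = m'" using k by presburger+
      then have "b" using m' by (simp add: b_def)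
      moreover have "x \<notin> ?N"
        using True height_new_vertices middle_grid_disjoint by blast
      ultimately show ?thesis
        using True unfolding x_def[symmetric] by (simp add: flip_def paste_def)
    next
      case False
      \<comment> \<open>Outside the open middle thirds, a point with \<open>b\<close> true is an end
        of its third, so it is pasted and \<open>paste\<close> fixes it as \<open>flip\<close>
        does.\<close>
      have "x \<in> ?N" if b
      proof -
        have "k = 1" "m \<in> A" using that by (auto simp: b_def)
        then have "\<not> (0 < \<sigma> \<and> \<sigma> < 1)"
          using False unfolding middle_iff hx by auto
        then have "\<sigma> = 0 \<or> \<sigma> = 1" using \<sigma> by linarith
        then have "s = 0 \<or> s = laakso_len j / 3"
          by (auto simp: \<sigma>_def laakso_len_def field_simps)
        then have "real k * (laakso_len j / 3) + s \<in> {laakso_len j / 3, 2 * (laakso_len j / 3)}"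
          using \<open>k = 1\<close> by auto
        then have "x = e (laakso_len j / 3) \<or> x = e (2 * (laakso_len j / 3))"
          unfolding x_def by (metis insertE singletonD)
        then show ?thesis using e by (auto simp: new_vertices_def)
      qed
      then show ?thesis
        using False unfolding x_def[symmetric] by (simp add: flip_def paste_def)
    qed
  qed
  then show ?thesis
    using laakso_edges_SucI[OF e k, of b] by (intro bexI) auto
qed

lemma path_flip:
  assumes "path_of_length (laakso_len j) (laakso_edges j) x y r"
  shows "path_of_length (laakso_len (Suc j)) (laakso_edges (Suc j)) (flip j A x) (flip j A y) r"
proof (rule path_of_length_map[OF _ path_of_length_trisect[OF _ assms]])
  show "0 \<le> laakso_len j"
    using laakso_len_pos[of j] by simp
  fix e
  assume "e \<in> trisect (laakso_len j) (laakso_edges j)"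
  then obtain e0 k where e0: "e0 \<in> laakso_edges j" "k < 3"
    and e: "e = (\<lambda>s. e0 (real k * (laakso_len j / 3) + s))"
    by (auto simp: trisect_def)
  obtain e' where "e' \<in> laakso_edges (Suc j)"
    "\<forall>s\<in>{0..laakso_len j / 3}. flip j A (e s) = e' s"
    using flip_edge[OF e0, of A] unfolding e by blast
  then show "\<exists>e'\<in>laakso_edges (Suc j). \<exists>c. \<forall>s\<in>{0..laakso_len j / 3}.
      s + c \<in> {0..laakso_len (Suc j)} \<and> flip j A (e s) = e' (s + c)"
    by (intro bexI[of _ e'] exI[of _ 0]) (auto simp: laakso_len_Suc)
qed

section \<open>Inclusions between the stages\<close>

lemma laakso_stage_iff:
  "x \<in> laakso_stage i \<longleftrightarrow> (\<exists>e\<in>laakso_edges i. \<exists>s\<in>{0..laakso_len i}. x = e s)"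
  by (auto simp: laakso_stage_def thickening_def)

lemma flip_in_stage:
  assumes "x \<in> laakso_stage j"
  shows "flip j A x \<in> laakso_stage (Suc j)"
proof -
  obtain e s where e: "e \<in> laakso_edges j" and s: "0 \<le> s" "s \<le> laakso_len j" and x: "x = e s"
    using assms by (auto simp: laakso_stage_iff)
  define k :: nat where
    "k = (if s \<le> laakso_len j / 3 then 0 else if s \<le> 2 * (laakso_len j / 3) then 1 else 2)"
  have k: "k < 3" "s - real k * (laakso_len j / 3) \<in> {0..laakso_len j / 3}"
    using s by (auto simp: k_def)
  obtain e' where "e' \<in> laakso_edges (Suc j)"
    "flip j A x = e' (s - real k * (laakso_len j / 3))"
    using flip_edge[OF e k(1), of A] k(2) x by (metis add.commute diff_add_cancel)
  then show ?thesis
    using k(2) unfolding laakso_stage_iff laakso_len_Suc by blast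
qed

lemma laakso_stage_mono: "i \<le> j \<Longrightarrow> laakso_stage i \<subseteq> laakso_stage j"
proof (rule lift_Suc_mono_le)
  show "laakso_stage n \<subseteq> laakso_stage (Suc n)" for n
    using flip_in_stage[where A = "{}"] by auto
qed

lemma has_second_stage: "x \<in> laakso_stage i \<Longrightarrow> has_second j x \<Longrightarrow> j < i"
  by (auto simp: laakso_stage_iff dest: has_second_edge)

text \<open>The projection of stage \<open>Suc i\<close> onto stage \<open>i\<close> that forgets
  the copy. Removing the outermost constructor is enough, since the last pasting puts
  \<open>Second i\<close> outermost.\<close>

definition drop_second :: "nat \<Rightarrow> laakso_point \<Rightarrow> laakso_point" where
  "drop_second i x = (case x of Base t \<Rightarrow> x | Second k y \<Rightarrow> if k = i then y else x)"

lemma drop_second_ident: "\<not> has_second i x \<Longrightarrow> drop_second i x = x"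
  by (cases x) (auto simp: drop_second_def)

lemma drop_second_paste: "\<not> has_second i x \<Longrightarrow> drop_second i (paste i N b x) = x"
  by (simp add: paste_def drop_second_ident) (simp add: drop_second_def)

text \<open>An edge of the new stage projects onto one third of an old edge; the shift is the
  starting point of that third.\<close>

lemma path_drop_second:
  assumes "path_of_length (laakso_len (Suc i)) (laakso_edges (Suc i)) x y r"
  shows "path_of_length (laakso_len i) (laakso_edges i) (drop_second i x) (drop_second i y) r"
proof (rule path_of_length_map[OF _ assms])
  fix e
  assume "e \<in> laakso_edges (Suc i)"
  then obtain b e' k where e': "e' \<in> laakso_edges i" and k: "k < 3" and e: "e = paste i
      (new_vertices (laakso_len i) (laakso_edges i)) b \<circ> (\<lambda>s. e' (real k * (laakso_len i / 3) + s))"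
    by (rule laakso_edges_SucE)
  have k': "k = 0 \<or> k = 1 \<or> k = 2" using k by auto
  have "s + real k * (laakso_len i / 3) \<in> {0..laakso_len i} \<and>
      drop_second i (e s) = e' (s + real k * (laakso_len i / 3))"
    if s: "s \<in> {0..laakso_len (Suc i)}" for s
  proof
    show "s + real k * (laakso_len i / 3) \<in> {0..laakso_len i}"
      using s k' by (auto simp: laakso_len_Suc)
    have "\<not> has_second i (e' (real k * (laakso_len i / 3) + s))"
      using has_second_edge[OF e'] by blast
    then show "drop_second i (e s) = e' (s + real k * (laakso_len i / 3))"
      unfolding e comp_def by (simp add: drop_second_paste add.commute)
  qed
  then show "\<exists>e'\<in>laakso_edges i. \<exists>c. \<forall>s\<in>{0..laakso_len (Suc i)}.
      s + c \<in> {0..laakso_len i} \<and> drop_second i (e s) = e' (s + c)"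
    using e' by blast
qed


section \<open>Distances\<close>

text \<open>Every new edge has a pasted end, and pasted points lie in the old stage, where induction
  applies. Connectedness keeps the infima of path lengths from being taken over the empty
  set.\<close>

lemma stage_connected_base:
  "x \<in> laakso_stage i \<Longrightarrow> \<exists>r. path_of_length (laakso_len i) (laakso_edges i) x (Base 0) r"
proof (induction i arbitrary: x)
  case 0
  then obtain s where "x = Base s" "s \<in> {0..laakso_len 0}"
    by (auto simp: laakso_stage_iff)
  then show ?case
    using path_of_length_edge[of Base "laakso_edges 0" s "laakso_len 0" 0] laakso_len_pos[of 0]
    by auto
next
  case (Suc i)
  let ?N = "new_vertices (laakso_len i) (laakso_edges i)"
  let ?P = "path_of_length (laakso_len (Suc i)) (laakso_edges (Suc i))"
  have old: "\<exists>r. ?P y (Base 0) r" if "y \<in> laakso_stage i" for y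
    using Suc.IH[OF that] path_flip[of i y "Base 0" _ "{}"] by auto
  obtain e s where e: "e \<in> laakso_edges (Suc i)" and s: "s \<in> {0..laakso_len (Suc i)}" "x = e s"
    using Suc.prems by (auto simp: laakso_stage_iff)
  obtain b e' k where e': "e' \<in> laakso_edges i" and k: "k < 3"
    and eq: "e = paste i ?N b \<circ> (\<lambda>s. e' (real k * (laakso_len i / 3) + s))"
    using e by (rule laakso_edges_SucE)
  \<comment> \<open>Chosen so that \<open>e t\<close> is a pasted point: the upper end of the first
    third, the lower end of the other two.\<close>
  define t where "t = (if k = 0 then laakso_len i / 3 else 0)"
  have t: "t \<in> {0..laakso_len (Suc i)}"
    using laakso_len_pos[of i] by (auto simp: t_def laakso_len_Suc)
  have "k = 0 \<or> k = 1 \<or> k = 2" using k by auto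
  then have "real k * (laakso_len i / 3) + t = laakso_len i / 3 \<or>
      real k * (laakso_len i / 3) + t = 2 * (laakso_len i / 3)"
    by (auto simp: t_def)
  then have "e' (real k * (laakso_len i / 3) + t) \<in> ?N"
    and "real k * (laakso_len i / 3) + t \<in> {0..laakso_len i}"
    using e' laakso_len_pos[of i] by (auto simp only: new_vertices_def) auto
  moreover from this(2) have "e' (real k * (laakso_len i / 3) + t) \<in> laakso_stage i"
    unfolding laakso_stage_iff using e' by blast
  ultimately have "e t \<in> laakso_stage i" by (simp add: eq paste_def)
  then obtain r where "?P (e t) (Base 0) r" using old by blast
  from path_of_length_trans[OF path_of_length_edge[OF e s(1) t] this] show ?case
    unfolding s(2) ..
qed

lemma stage_connected:
  assumes "x \<in> laakso_stage i" "y \<in> laakso_stage i"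
  obtains r where "path_of_length (laakso_len i) (laakso_edges i) x y r"
proof -
  obtain r q where "path_of_length (laakso_len i) (laakso_edges i) x (Base 0) r"
    "path_of_length (laakso_len i) (laakso_edges i) y (Base 0) q"
    using stage_connected_base assms by blast
  from path_of_length_trans[OF this(1) path_of_length_sym[OF this(2)]] show ?thesis
    by (rule that)
qed

lemma stage_dist_ge:
  assumes "edge_lipschitz \<phi>" "x \<in> laakso_stage i" "y \<in> laakso_stage i"
  shows "\<bar>\<phi> x - \<phi> y\<bar> \<le> stage_dist i x y"
  unfolding stage_dist_def path_dist_def
proof (rule cInf_greatest)
  show "{r. path_of_length (laakso_len i) (laakso_edges i) x y r} \<noteq> {}"
    using stage_connected[OF assms(2,3)] by blast
  show "\<bar>\<phi> x - \<phi> y\<bar> \<le> r" if "r \<in> {r. path_of_length (laakso_len i) (laakso_edges i) x y r}" for r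
    using that assms(1) path_of_length_lipschitz[of "laakso_edges i" \<phi>]
    unfolding edge_lipschitz_def by blast
qed

lemma stage_dist_flip_le:
  assumes "x \<in> laakso_stage j" "y \<in> laakso_stage j"
  shows "stage_dist (Suc j) (flip j A x) (flip j A y) \<le> stage_dist j x y"
proof -
  obtain r where "path_of_length (laakso_len j) (laakso_edges j) x y r"
    using assms by (rule stage_connected)
  then show ?thesis
    unfolding stage_dist_def by (rule path_dist_mono) (rule path_flip)
qed

text \<open>The projection \<open>drop_second i\<close> fixes the points of stage \<open>i\<close>
  and preserves path lengths, so the larger stage offers no shortcuts.\<close>

lemma stage_dist_Suc_ge:
  assumes "x \<in> laakso_stage i" "y \<in> laakso_stage i"
  shows "stage_dist i x y \<le> stage_dist (Suc i) x y"
proof -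
  have drop: "drop_second i x = x" "drop_second i y = y"
    using assms has_second_stage by (blast intro: drop_second_ident)+
  have "x \<in> laakso_stage (Suc i)" "y \<in> laakso_stage (Suc i)"
    using assms laakso_stage_mono[of i "Suc i"] by auto
  then obtain r where "path_of_length (laakso_len (Suc i)) (laakso_edges (Suc i)) x y r"
    by (rule stage_connected)
  then show ?thesis
    unfolding stage_dist_def by (rule path_dist_mono) (drule path_drop_second, simp add: drop)
qed

lemma stage_dist_ge_earlier:
  assumes "k \<le> i" "x \<in> laakso_stage k" "y \<in> laakso_stage k"
  shows "stage_dist k x y \<le> stage_dist i x y"
  using assms(1)
proof (induction rule: dec_induct)
  case (step n)
  note step.IH
  also have "stage_dist n x y \<le> stage_dist (Suc n) x y"
    using laakso_stage_mono[OF step.hyps(1)] assms(2,3) by (intro stage_dist_Suc_ge) auto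
  finally show ?case .
qed simp

text \<open>The least stage containing both points comes no later than \<open>i\<close>, and
  distances do not decrease from stage to stage.\<close>

lemma laakso_dist_le:
  assumes "x \<in> laakso_stage i" "y \<in> laakso_stage i"
  shows "laakso_dist x y \<le> stage_dist i x y"
proof -
  let ?P = "\<lambda>i. x \<in> laakso_stage i \<and> y \<in> laakso_stage i"
  have "?P (LEAST i. ?P i)" using assms by (intro LeastI[of ?P i]) auto
  moreover have "(LEAST i. ?P i) \<le> i" using assms by (intro Least_le) auto
  ultimately show ?thesis unfolding laakso_dist_def by (intro stage_dist_ge_earlier) auto
qed

lemma laakso_dist_ge:
  assumes "edge_lipschitz \<phi>" "x \<in> laakso_stage i" "y \<in> laakso_stage i"
  shows "\<bar>\<phi> x - \<phi> y\<bar> \<le> laakso_dist x y"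
proof -
  let ?P = "\<lambda>i. x \<in> laakso_stage i \<and> y \<in> laakso_stage i"
  have "?P (LEAST i. ?P i)" using assms by (intro LeastI[of ?P i]) auto
  then show ?thesis unfolding laakso_dist_def by (intro stage_dist_ge assms(1)) auto
qed

text \<open>The values of \<open>copy_height j\<close> at the two points are opposite: a path must
  reach the grid and come back.\<close>

lemma laakso_dist_copies:
  assumes "x \<in> laakso_stage i" "y \<in> laakso_stage i" "height x = height y"
    and "has_second j x \<noteq> has_second j y"
  shows "2 * infdist (height x) (grid j) \<le> laakso_dist x y"
proof -
  have "\<bar>copy_height j x - copy_height j y\<bar> = 2 * infdist (height x) (grid j)"
    using assms(3,4) infdist_nonneg[of "height y" "grid j"] by (auto simp: copy_height_def)
  then show ?thesis
    using laakso_dist_ge[OF edge_lipschitz_copy_height assms(1,2), of j] by simp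
qed

text \<open>In units of \<open>1 / (6 * 3 ^ j)\<close> the midpoint is an odd integer and the grid
  points are even ones.\<close>

lemma infdist_grid_midpoint: "1 / (6 * 3 ^ j) \<le> infdist ((real m + 1 / 2) / 3 ^ j) (grid j)"
proof -
  have "1 / (6 * 3 ^ j) \<le> dist ((real m + 1 / 2) / 3 ^ j) (of_int k / 3 ^ Suc j)" for k :: int
  proof -
    have "1 \<le> \<bar>6 * int m + 3 - 2 * k\<bar>" by presburger
    then have "1 \<le> \<bar>of_int (6 * int m + 3 - 2 * k) :: real\<bar>" by linarith
    moreover have "(real m + 1 / 2) / 3 ^ j - of_int k / 3 ^ Suc j
        = of_int (6 * int m + 3 - 2 * k) / (6 * 3 ^ j)"
      by (simp add: field_simps)
    ultimately show ?thesis
      by (simp only: dist_real_def abs_divide) (simp add: divide_right_mono)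
  qed
  then show ?thesis
    unfolding infdist_def grid_def by (auto intro!: cINF_greatest)
qed

lemma midpoint_in_middle: "m \<in> A \<Longrightarrow> (real m + 1 / 2) / 3 ^ j \<in> middle j A"
  unfolding middle_iff by (rule bexI[of _ m]) (auto simp: field_simps)


section \<open>Geodesics between the two base vertices\<close>

lemma Base_in_stage: "t \<in> {0..1} \<Longrightarrow> Base t \<in> laakso_stage i"
  using laakso_stage_mono[of 0 i]
  by (force simp: laakso_stage_iff[of _ 0] laakso_len_def)

lemma Base_dist_le: "s \<in> {0..1} \<Longrightarrow> t \<in> {0..1} \<Longrightarrow> stage_dist i (Base s) (Base t) \<le> \<bar>s - t\<bar>"
proof (induction i)
  case 0
  have "path_of_length (laakso_len 0) (laakso_edges 0) (Base s) (Base t) \<bar>s - t\<bar>"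
    using 0 by (intro path_of_length_edge) (auto simp: laakso_len_def)
  then show ?case
    unfolding stage_dist_def path_dist_def
    by (intro cInf_lower) (auto intro!: bdd_belowI[of _ 0] simp: path_of_length_nonneg)
next
  case (Suc i)
  then show ?case
    using stage_dist_flip_le[of "Base s" i "Base t" "{}"] Base_in_stage by force
qed

lemma Base_dist: "s \<in> {0..1} \<Longrightarrow> t \<in> {0..1} \<Longrightarrow> stage_dist i (Base s) (Base t) = \<bar>s - t\<bar>"
  using stage_dist_ge[OF edge_lipschitz_height, of "Base s" i "Base t"] Base_dist_le[of s t i]
    Base_in_stage[of s i] Base_in_stage[of t i] by simp

definition stage_geodesic :: "nat \<Rightarrow> (real \<Rightarrow> laakso_point) \<Rightarrow> bool" where
  "stage_geodesic i \<gamma> \<longleftrightarrow> geodesic (laakso_stage i) (stage_dist i) (Base 0) (Base 1) \<gamma>"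

lemma stage_geodesic_iff:
  "stage_geodesic i \<gamma> \<longleftrightarrow> \<gamma> ` {0..1} \<subseteq> laakso_stage i \<and> \<gamma> 0 = Base 0 \<and> \<gamma> 1 = Base 1 \<and>
     (\<forall>s\<in>{0..1}. \<forall>t\<in>{0..1}. stage_dist i (\<gamma> s) (\<gamma> t) = \<bar>s - t\<bar>)"
  by (simp add: stage_geodesic_def geodesic_def Base_dist)

lemma marked_geodesics_eq: "marked_geodesics \<iota> = {\<iota> ` \<gamma> ` {0..1} | \<gamma> i. stage_geodesic i \<gamma>}"
  by (simp add: marked_geodesics_def stage_geodesic_def Base_dist)

lemma stage_geodesic_Base: "stage_geodesic 0 Base"
  using Base_in_stage by (auto simp: stage_geodesic_iff Base_dist)

lemma stage_geodesic_in_stage: "stage_geodesic i \<gamma> \<Longrightarrow> t \<in> {0..1} \<Longrightarrow> \<gamma> t \<in> laakso_stage i"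
  by (auto simp: stage_geodesic_iff)

text \<open>The height is 1-Lipschitz along the curve and rises from 0 to 1 in unit time, which
  leaves no slack.\<close>

lemma height_stage_geodesic:
  assumes \<gamma>: "stage_geodesic i \<gamma>" and t: "t \<in> {0..1}"
  shows "height (\<gamma> t) = t"
proof -
  have "\<bar>height (\<gamma> s) - height (\<gamma> t)\<bar> \<le> \<bar>s - t\<bar>" if "s \<in> {0..1}" for s
    using stage_dist_ge[OF edge_lipschitz_height, of "\<gamma> s" i "\<gamma> t"] that t \<gamma>
    by (auto simp: stage_geodesic_iff image_subset_iff)
  from this[of 0] this[of 1] show ?thesis
    using t \<gamma> by (auto simp: stage_geodesic_iff)
qed

text \<open>Flipping does not increase distances, and as it preserves heights it cannot decrease
  them along a geodesic.\<close>

lemma stage_geodesic_flip: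
  assumes \<gamma>: "stage_geodesic j \<gamma>"
  shows "stage_geodesic (Suc j) (flip j A \<circ> \<gamma>)"
proof -
  have "0 \<notin> middle j A" "1 \<notin> middle j A"
    using multiple_notin_middle[of 0 j A] multiple_notin_middle[of "3 ^ j" j A] by auto
  then have "flip j A (\<gamma> 0) = Base 0" "flip j A (\<gamma> 1) = Base 1"
    using \<gamma> by (auto simp: stage_geodesic_iff flip_def)
  moreover have "stage_dist (Suc j) (flip j A (\<gamma> s)) (flip j A (\<gamma> t)) = \<bar>s - t\<bar>"
    if s: "s \<in> {0..1}" and t: "t \<in> {0..1}" for s t
  proof (rule antisym)
    note st = stage_geodesic_in_stage[OF \<gamma> s] stage_geodesic_in_stage[OF \<gamma> t]
    show "stage_dist (Suc j) (flip j A (\<gamma> s)) (flip j A (\<gamma> t)) \<le> \<bar>s - t\<bar>"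
      using stage_dist_flip_le[OF st, of A] \<gamma> s t by (auto simp: stage_geodesic_iff)
    show "\<bar>s - t\<bar> \<le> stage_dist (Suc j) (flip j A (\<gamma> s)) (flip j A (\<gamma> t))"
      using stage_dist_ge[OF edge_lipschitz_height flip_in_stage[OF st(1), of A]
          flip_in_stage[OF st(2), of A]] height_stage_geodesic[OF \<gamma>] s t by simp
  qed
  ultimately show ?thesis
    using stage_geodesic_in_stage[OF \<gamma>] flip_in_stage by (auto simp: stage_geodesic_iff)
qed

lemma stage_geodesic_mono:
  assumes "stage_geodesic i \<gamma>" "i \<le> j"
  shows "stage_geodesic j \<gamma>"
  using assms(2)
proof (induction rule: dec_induct)
  case (step n)
  then show ?case using stage_geodesic_flip[of n \<gamma> "{}"] by (simp add: comp_def)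
qed (rule assms(1))

text \<open>Squeezed between the difference of heights and the distance in stage
  \<open>i\<close>.\<close>

lemma laakso_dist_stage_geodesic:
  assumes \<gamma>: "stage_geodesic i \<gamma>" and "s \<in> {0..1}" "t \<in> {0..1}"
  shows "laakso_dist (\<gamma> s) (\<gamma> t) = \<bar>s - t\<bar>"
  using laakso_dist_le[of "\<gamma> s" i "\<gamma> t"] laakso_dist_ge[OF edge_lipschitz_height, of "\<gamma> s" i "\<gamma> t"]
    stage_geodesic_in_stage[OF \<gamma>] height_stage_geodesic[OF \<gamma>] assms
  by (auto simp: stage_geodesic_iff)

text \<open>Twice the distance from the midpoint to the grid; \<open>m < 3 ^ j\<close> keeps the
  midpoint in \<open>{0..1}\<close>.\<close>

lemma laakso_dist_flip_midpoint:
  assumes \<gamma>: "stage_geodesic j \<gamma>" and "m \<in> A" "m < 3 ^ j"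
  defines "t \<equiv> (real m + 1 / 2) / 3 ^ j"
  shows "1 / (3 * 3 ^ j) \<le> laakso_dist (\<gamma> t) (flip j A (\<gamma> t))"
proof -
  have "real (m + 1) \<le> real (3 ^ j)" using assms(3) by (intro of_nat_mono) simp
  then have t: "t \<in> {0..1}" by (auto simp: t_def field_simps)
  have st: "\<gamma> t \<in> laakso_stage j" and h: "height (\<gamma> t) = t"
    using stage_geodesic_in_stage[OF \<gamma> t] height_stage_geodesic[OF \<gamma> t] .
  have "height (\<gamma> t) \<in> middle j A"
    unfolding h unfolding t_def using assms(2) by (rule midpoint_in_middle)
  then have "has_second j (\<gamma> t) \<noteq> has_second j (flip j A (\<gamma> t))"
    using has_second_stage[OF st, of j] by (auto simp: flip_def)
  then have "2 * infdist (height (\<gamma> t)) (grid j) \<le> laakso_dist (\<gamma> t) (flip j A (\<gamma> t))"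
    using st flip_in_stage[OF st, of A] laakso_stage_mono[of j "Suc j"]
    by (intro laakso_dist_copies[of _ "Suc j"]) auto
  then show ?thesis
    using infdist_grid_midpoint[of j m, folded t_def] unfolding h by simp
qed


section \<open>Subdivided geodesics\<close>

lemma interleave_Suc: "interleave (Suc n) w z = interleave n w z @ [z (Suc n), w (Suc n)]"
  by (simp add: interleave_def)

lemma interleave_map: "interleave n (f \<circ> w) (f \<circ> z) = map f (interleave n w z)"
  by (simp add: interleave_def map_concat comp_def)

lemma set_interleave: "set (interleave n w z) = w ` {..n} \<union> z ` {1..n}"
  by (induction n) (auto simp: interleave_Suc atMost_Suc atLeastAtMostSuc_conv interleave_def)

text \<open>A general \<open>R\<close> covers both directions of travel. The second conjunct carries
  the induction: by transitivity all entries precede the two appended ones.\<close>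

lemma sorted_wrt_interleave:
  assumes R: "transp R" "reflp R"
    and "\<And>i. i \<in> {1..n} \<Longrightarrow> R (w (i - 1)) (z i) \<and> R (z i) (w i)"
  shows "sorted_wrt R (interleave n w z) \<and> (\<forall>x\<in>set (interleave n w z). R x (w n))"
  using assms(3)
proof (induction n)
  case 0
  show ?case using R(2) by (simp add: interleave_def reflpD)
next
  case (Suc n)
  then have "R (w n) (z (Suc n))" "R (z (Suc n)) (w (Suc n))"
    using Suc.prems[of "Suc n"] by auto
  moreover have IH: "sorted_wrt R (interleave n w z)" "\<forall>x\<in>set (interleave n w z). R x (w n)"
    using Suc by auto
  ultimately have "\<forall>x\<in>set (interleave n w z). R x (z (Suc n)) \<and> R x (w (Suc n))"
    using R(1) by (meson transpD)
  then show ?case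
    using IH \<open>R (z (Suc n)) (w (Suc n))\<close> R(2)
    by (auto simp: interleave_Suc sorted_wrt_append reflpD)
qed

lemma sorted_wrt_interleave_nodes:
  assumes "transp R" "reflp R"
    and "\<And>i. i \<in> {1..n} \<Longrightarrow> R (w (i - 1)) (z i) \<and> R (z i) (w i)"
  shows "sorted_wrt R (map w [0..<Suc n])"
  using assms(3)
proof (induction n)
  case (Suc n)
  have "sorted_wrt R (interleave (Suc n) w z) \<and> (\<forall>x\<in>set (interleave (Suc n) w z). R x (w (Suc n)))"
    using assms Suc.prems by (intro sorted_wrt_interleave) auto
  then have "\<forall>i\<le>n. R (w i) (w (Suc n))" by (auto simp: set_interleave)
  then show ?case using Suc by (auto simp: sorted_wrt_append)
qed simp

text \<open>\<open>T\<close> gives the heights of the points \<open>w\<close>, \<open>Z\<close>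
  those of the points between them, \<open>A\<close> the intervals to be switched, and
  \<open>I\<close> indices whose \<open>Z i\<close> is the midpoint of a switched interval.\<close>

lemma subdivision_heights_mono:
  assumes ab: "0 \<le> a" "b \<le> 1" and large: "4 \<le> 3 ^ j * (b - a)"
  obtains T Z :: "nat \<Rightarrow> real" and A I :: "nat set" where
    "T 0 = a" "T (3 ^ j) = b"
    "\<And>i. i \<in> {1..3 ^ j} \<Longrightarrow> T (i - 1) \<le> Z i \<and> Z i \<le> T i"
    "\<And>i. T i \<in> {0..1} - middle j A" "\<And>i. Z i \<in> {0..1}"
    "I \<subseteq> {1..3 ^ j}" "3 ^ j * (b - a) / 2 \<le> real (card I)"
    "\<And>i. i \<in> I \<Longrightarrow> \<exists>m\<in>A. m < 3 ^ j \<and> Z i = (real m + 1 / 2) / 3 ^ j"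
proof -
  have "0 < 3 ^ j * (b - a)" using large by linarith
  then have "a < b" by (simp add: zero_less_mult_iff)
  \<comment> \<open>Clipping to \<open>{a..b}\<close> makes the number of subdivision points always
    \<open>3 ^ j\<close>, at the cost of repeated points near the ends.\<close>
  define clip where "clip x = max a (min b x)" for x
  have clip: "clip x \<le> clip y" if "x \<le> y" for x y
    using that by (auto simp: clip_def)
  have clip01: "clip x \<in> {0..1}" for x
    using ab \<open>a < b\<close> by (auto simp: clip_def)
  define T where "T i = clip (real i / 3 ^ j)" for i
  define Z where "Z i = clip ((real i - 1 / 2) / 3 ^ j)" for i
  \<comment> \<open>Only intervals lying entirely between \<open>a\<close> and \<open>b\<close> are
    switched.\<close>
  define A where "A = {m. a \<le> real m / 3 ^ j \<and> (real m + 1) / 3 ^ j \<le> b}"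
  define p where "p = nat \<lceil>3 ^ j * a\<rceil>"
  define q where "q = nat \<lfloor>3 ^ j * b\<rfloor>"
  have "0 \<le> 3 ^ j * a" "0 \<le> 3 ^ j * b" using ab \<open>a < b\<close> by auto
  then have p: "3 ^ j * a \<le> real p" "real p < 3 ^ j * a + 1"
    and q: "real q \<le> 3 ^ j * b" "3 ^ j * b - 1 < real q"
    unfolding p_def q_def by linarith+
  have pq: "m \<in> A \<and> m < 3 ^ j" if m: "m \<in> {p..<q}" for m
  proof -
    have "real p \<le> real m" "real m + 1 \<le> real q" using m by auto
    then have m': "3 ^ j * a \<le> real m" "real m + 1 \<le> 3 ^ j * b" using p q by linarith+
    have "3 ^ j * b \<le> 3 ^ j" using ab by simp
    then have "real m < 3 ^ j" using m' by linarith
    then have "m < 3 ^ j" by simp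
    then show ?thesis using m' by (simp add: A_def field_simps)
  qed
  show ?thesis
  \<comment> \<open>The interval with number \<open>m\<close> runs from \<open>m / 3 ^ j\<close> to
    \<open>Suc m / 3 ^ j\<close>, so its midpoint has index \<open>Suc m\<close>.\<close>
  proof (rule that[of T Z A "Suc ` {p..<q}"])
    show "T 0 = a" "T (3 ^ j) = b"
      using ab \<open>a < b\<close> by (auto simp: T_def clip_def)
    show "T (i - 1) \<le> Z i \<and> Z i \<le> T i" if "i \<in> {1..3 ^ j}" for i
      using that unfolding T_def Z_def by (auto intro!: clip divide_right_mono simp: of_nat_diff)
    show "Z i \<in> {0..1}" for i
      unfolding Z_def by (rule clip01)
    show "T i \<in> {0..1} - middle j A" for i
    proof
      show "T i \<in> {0..1}" unfolding T_def by (rule clip01)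
      \<comment> \<open>An interval in \<open>A\<close> lies between \<open>a\<close> and
        \<open>b\<close>, so its open middle third contains neither.\<close>
      have "a \<notin> middle j A" "b \<notin> middle j A"
        by (auto simp: middle_iff A_def field_simps)
      moreover have "T i = a \<or> T i = b \<or> T i = real i / 3 ^ j"
        by (auto simp: T_def clip_def max_def min_def)
      ultimately show "T i \<notin> middle j A"
        using multiple_notin_middle[of i j A] by metis
    qed
    show "Suc ` {p..<q} \<subseteq> {1..3 ^ j}"
      using pq by (force simp: Suc_le_eq)
    \<comment> \<open>Rounding \<open>p\<close> up and \<open>q\<close> down loses less than 2,
      which is at most half of the total by \<open>large\<close>.\<close>
    have "3 ^ j * (b - a) / 2 \<le> real q - real p"
      using p q large by (simp add: right_diff_distrib)
    also have "\<dots> \<le> real (card (Suc ` {p..<q}))"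
      by (simp add: card_image)
    finally show "3 ^ j * (b - a) / 2 \<le> real (card (Suc ` {p..<q}))" .
    show "\<exists>m\<in>A. m < 3 ^ j \<and> Z i = (real m + 1 / 2) / 3 ^ j" if i: "i \<in> Suc ` {p..<q}" for i
    proof -
      obtain m where m: "m \<in> {p..<q}" "i = Suc m" using i by blast
      have "a \<le> real m / 3 ^ j" "real m / 3 ^ j \<le> (real m + 1 / 2) / 3 ^ j"
        "(real m + 1 / 2) / 3 ^ j \<le> (real m + 1) / 3 ^ j" "(real m + 1) / 3 ^ j \<le> b"
        using pq[OF m(1)] by (auto simp: A_def intro!: divide_right_mono)
      then have "clip ((real m + 1 / 2) / 3 ^ j) = (real m + 1 / 2) / 3 ^ j"
        by (simp add: clip_def)
      moreover have "real i - 1 / 2 = real m + 1 / 2" by (simp add: m(2))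
      ultimately have "Z i = (real m + 1 / 2) / 3 ^ j" by (simp only: Z_def)
      then show ?thesis using pq[OF m(1)] by blast
    qed
  qed
qed

text \<open>If \<open>b < a\<close>, the subdivision from \<open>b\<close> to \<open>a\<close> is
  traversed backwards, with \<open>R\<close> the reversed order.\<close>

lemma subdivision_heights:
  assumes ab: "a \<in> {0..1}" "b \<in> {0..1}" and large: "4 \<le> 3 ^ j * \<bar>a - b\<bar>"
  obtains T Z :: "nat \<Rightarrow> real" and A I :: "nat set" and R :: "real \<Rightarrow> real \<Rightarrow> bool" where
    "T 0 = a" "T (3 ^ j) = b" "R = (\<le>) \<or> R = (\<ge>)"
    "\<And>i. i \<in> {1..3 ^ j} \<Longrightarrow> R (T (i - 1)) (Z i) \<and> R (Z i) (T i)"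
    "\<And>i. T i \<in> {0..1} - middle j A" "\<And>i. Z i \<in> {0..1}"
    "I \<subseteq> {1..3 ^ j}" "3 ^ j * \<bar>a - b\<bar> / 2 \<le> real (card I)"
    "\<And>i. i \<in> I \<Longrightarrow> \<exists>m\<in>A. m < 3 ^ j \<and> Z i = (real m + 1 / 2) / 3 ^ j"
proof (cases "a \<le> b")
  case True
  then have pre: "0 \<le> a" "b \<le> 1" "4 \<le> 3 ^ j * (b - a)"
    using ab large by (auto simp: abs_of_nonpos)
  show ?thesis
  proof (rule subdivision_heights_mono[OF pre])
    fix T Z :: "nat \<Rightarrow> real" and A I :: "nat set"
    assume *: "T 0 = a" "T (3 ^ j) = b"
      "\<And>i. i \<in> {1..3 ^ j} \<Longrightarrow> T (i - 1) \<le> Z i \<and> Z i \<le> T i"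
      "\<And>i. T i \<in> {0..1} - middle j A" "\<And>i. Z i \<in> {0..1}"
      "I \<subseteq> {1..3 ^ j}" "3 ^ j * (b - a) / 2 \<le> real (card I)"
      "\<And>i. i \<in> I \<Longrightarrow> \<exists>m\<in>A. m < 3 ^ j \<and> Z i = (real m + 1 / 2) / 3 ^ j"
    show ?thesis
      by (rule that[of T "(\<le>)" Z A I]) (use * True in \<open>auto simp: abs_of_nonpos\<close>)
  qed
next
  case False
  then have pre: "0 \<le> b" "a \<le> 1" "4 \<le> 3 ^ j * (a - b)"
    using ab large by (auto simp: abs_of_nonneg)
  show ?thesis
  proof (rule subdivision_heights_mono[OF pre])
    fix T Z :: "nat \<Rightarrow> real" and A I :: "nat set"
    assume *: "T 0 = b" "T (3 ^ j) = a"
      "\<And>i. i \<in> {1..3 ^ j} \<Longrightarrow> T (i - 1) \<le> Z i \<and> Z i \<le> T i"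
      "\<And>i. T i \<in> {0..1} - middle j A" "\<And>i. Z i \<in> {0..1}"
      "I \<subseteq> {1..3 ^ j}" "3 ^ j * (a - b) / 2 \<le> real (card I)"
      "\<And>i. i \<in> I \<Longrightarrow> \<exists>m\<in>A. m < 3 ^ j \<and> Z i = (real m + 1 / 2) / 3 ^ j"
    \<comment> \<open>The \<open>i\<close>-th piece lies between nodes \<open>i - 1\<close> and
      \<open>i\<close>; reversal sends node \<open>i\<close> to \<open>3 ^ j - i\<close>, hence
      piece \<open>i\<close> to \<open>3 ^ j + 1 - i\<close>.\<close>
    let ?f = "\<lambda>i. 3 ^ j + 1 - i"
    show ?thesis
    proof (rule that[of "\<lambda>i. T (3 ^ j - i)" "(\<ge>)" "\<lambda>i. Z (?f i)" A "?f ` I"])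
      show "Z (?f i) \<le> T (3 ^ j - (i - 1)) \<and> T (3 ^ j - i) \<le> Z (?f i)" if "i \<in> {1..3 ^ j}" for i
      proof -
        have "?f i \<in> {1..3 ^ j}" "3 ^ j - (i - 1) = ?f i" "3 ^ j - i = ?f i - 1"
          using that by auto
        then show ?thesis using *(3)[of "?f i"] by simp
      qed
      have "inj_on ?f I"
      proof (rule inj_onI)
        fix x y assume "x \<in> I" "y \<in> I" "?f x = ?f y"
        moreover have "x \<le> 3 ^ j" "y \<le> 3 ^ j" using calculation *(6) by auto
        ultimately show "x = y" by linarith
      qed
      then show "3 ^ j * \<bar>a - b\<bar> / 2 \<le> real (card (?f ` I))"
        using *(7) False by (simp add: card_image)
      show "?f ` I \<subseteq> {1..3 ^ j}"
        using *(6) by (auto simp: subset_iff)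
      show "\<exists>m\<in>A. m < 3 ^ j \<and> Z (?f i) = (real m + 1 / 2) / 3 ^ j" if "i \<in> ?f ` I" for i
      proof -
        obtain k where "k \<in> I" "i = ?f k" using \<open>i \<in> ?f ` I\<close> by blast
        moreover have "?f (?f k) = k" using \<open>k \<in> I\<close> *(6) by auto
        ultimately show ?thesis using *(8)[of k] by simp
      qed
    qed (use * in auto)
  qed
qed


section \<open>The completion\<close>

lemma completion_dist:
  assumes "is_completion laakso laakso_dist M d \<iota>"
    and "x \<in> laakso_stage i" "y \<in> laakso_stage i"
  shows "d (\<iota> x) (\<iota> y) = laakso_dist x y"
  using assms by (auto simp: is_completion_def laakso_def)

lemma completion_dist_geodesic:
  assumes "is_completion laakso laakso_dist M d \<iota>" "stage_geodesic i \<gamma>"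
    and "s \<in> {0..1}" "t \<in> {0..1}"
  shows "d (\<iota> (\<gamma> s)) (\<iota> (\<gamma> t)) = \<bar>s - t\<bar>"
  using completion_dist[OF assms(1)] stage_geodesic_in_stage[OF assms(2)]
    laakso_dist_stage_geodesic[OF assms(2)] assms(3,4) by metis

lemma listed_in_order_stage_geodesic:
  assumes compl: "is_completion laakso laakso_dist M d \<iota>" and \<gamma>: "stage_geodesic i \<gamma>"
    and ts: "set ts \<subseteq> {0..1}" "sorted ts \<or> sorted (rev ts)"
  shows "listed_in_order M d (\<iota> (Base 0)) (\<iota> (Base 1)) (\<iota> ` \<gamma> ` {0..1}) (map (\<iota> \<circ> \<gamma>) ts)"
proof -
  have ends: "\<gamma> 0 = Base 0" "\<gamma> 1 = Base 1" using \<gamma> by (auto simp: stage_geodesic_iff)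
  have "d (\<iota> (Base 0)) (\<iota> (Base 1)) = 1"
    using completion_dist_geodesic[OF compl \<gamma>, of 0 1] by (simp add: ends)
  moreover have "\<iota> (\<gamma> t) \<in> M" if "t \<in> {0..1}" for t
    using stage_geodesic_in_stage[OF \<gamma> that] compl by (auto simp: is_completion_def laakso_def)
  ultimately show ?thesis
    unfolding listed_in_order_def geodesic_def
    using ends ts completion_dist_geodesic[OF compl \<gamma>]
    by (intro exI[of _ "\<iota> \<circ> \<gamma>"] exI[of _ ts]) (auto simp: image_comp)
qed

lemma listed_in_order_marked:
  assumes "is_completion laakso laakso_dist M d \<iota>" "stage_geodesic i \<gamma>"
    and "set ts \<subseteq> {0..1}" "sorted ts \<or> sorted (rev ts)"
  shows "\<exists>G\<in>marked_geodesics \<iota>.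
    listed_in_order M d (\<iota> (Base 0)) (\<iota> (Base 1)) G (map (\<iota> \<circ> \<gamma>) ts)"
  using listed_in_order_stage_geodesic[OF assms] assms(2) unfolding marked_geodesics_eq by blast

text \<open>For each \<open>j\<close>, switch coordinate \<open>j\<close> of the base segment on all
  middle thirds. Only the \<open>j\<close>-th of these geodesics uses the second copy of the
  \<open>j\<close>-th pasting.\<close>

lemma infinite_marked_geodesics:
  assumes compl: "is_completion laakso laakso_dist M d \<iota>"
  shows "infinite (marked_geodesics \<iota>)"
proof -
  define \<gamma> where "\<gamma> j = flip j UNIV \<circ> Base" for j
  define G where "G j = \<iota> ` \<gamma> j ` {0..1}" for j
  have \<gamma>: "stage_geodesic (Suc j) (\<gamma> j)" for j
    unfolding \<gamma>_def by (intro stage_geodesic_flip stage_geodesic_mono[OF stage_geodesic_Base]) simp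
  have "inj G"
  proof (rule injI, rule ccontr)
    fix j k assume eq: "G j = G k" and "j \<noteq> k"
    \<comment> \<open>The midpoint of the first switched third of level \<open>j\<close>.\<close>
    define t :: real where "t = (1 / 2) / 3 ^ j"
    have t: "t \<in> {0..1}"
      using one_le_power[of "3 :: real" j] by (simp add: t_def field_simps del: one_le_power)
    obtain s where s: "s \<in> {0..1}" and \<iota>: "\<iota> (\<gamma> j t) = \<iota> (\<gamma> k s)"
      using t eq unfolding G_def by blast
    define x y where "x = \<gamma> j t" and "y = \<gamma> k s"
    define i where "i = max (Suc j) (Suc k)"
    have xy: "x \<in> laakso_stage i" "y \<in> laakso_stage i"
      using stage_geodesic_in_stage[OF \<gamma> t, of j] stage_geodesic_in_stage[OF \<gamma> s, of k]
        laakso_stage_mono[of "Suc j" i] laakso_stage_mono[of "Suc k" i]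
      by (auto simp: x_def y_def i_def)
    \<comment> \<open>Equal images give distance 0 in the space itself; this forces equal heights,
      and then the differing coordinates contradict \<open>laakso_dist_copies\<close>.\<close>
    have "d (\<iota> x) (\<iota> y) = 0"
      using completion_dist_geodesic[OF compl \<gamma> s s, of k] \<iota> by (simp add: x_def y_def)
    then have 0: "laakso_dist x y = 0"
      using completion_dist[OF compl xy] by simp
    have hx: "height x = t" by (simp add: x_def \<gamma>_def)
    have "height x = height y"
      using laakso_dist_ge[OF edge_lipschitz_height xy] 0 by simp
    moreover have "t \<in> middle j UNIV"
      using midpoint_in_middle[of 0 UNIV j] by (simp add: t_def)
    then have "has_second j x \<noteq> has_second j y"
      using \<open>j \<noteq> k\<close> by (simp add: x_def y_def \<gamma>_def flip_def)
    ultimately have "2 * infdist t (grid j) \<le> 0"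
      using laakso_dist_copies[OF xy, of j] 0 hx by simp
    moreover have "0 < infdist t (grid j)"
      by (rule less_le_trans[of 0 "1 / (6 * 3 ^ j)"])
        (use infdist_grid_midpoint[of j 0] in \<open>simp_all add: t_def\<close>)
    ultimately show False by simp
  qed
  then have "infinite (range G)" by (rule range_inj_infinite)
  moreover have "range G \<subseteq> marked_geodesics \<iota>"
    using \<gamma> unfolding marked_geodesics_eq G_def by blast
  ultimately show ?thesis using infinite_super by blast
qed

theorem proposition4p3:
  fixes M :: "'c set" and d :: "'c \<Rightarrow> 'c \<Rightarrow> real" and \<iota> :: "laakso_point \<Rightarrow> 'c"
    and u v :: 'c
  assumes completion: "is_completion laakso laakso_dist M d \<iota>"
    and u: "u = \<iota> (Base 0)" and v: "v = \<iota> (Base 1)"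
  shows "infinite (marked_geodesics \<iota>) \<and>
    (\<exists>c>0. \<forall>u0 v0. (\<exists>G\<in>marked_geodesics \<iota>. u0 \<in> G \<and> v0 \<in> G) \<longrightarrow>
      (\<exists>n\<ge>1. \<exists>w z z' :: nat \<Rightarrow> 'c.
         w 0 = u0 \<and> w n = v0 \<and>
         (\<exists>G\<in>marked_geodesics \<iota>. listed_in_order M d u v G (map w [0..<Suc n])) \<and>
         (\<exists>G\<in>marked_geodesics \<iota>. listed_in_order M d u v G (interleave n w z)) \<and>
         (\<exists>G\<in>marked_geodesics \<iota>. listed_in_order M d u v G (interleave n w z')) \<and>
         (\<forall>i\<in>{1..n}. d (w i) (z i) = d (w i) (z' i) \<and>
                     d (w (i - 1)) (z i) = d (w (i - 1)) (z' i)) \<and>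
         (\<Sum>i=1..n. d (z i) (z' i)) \<ge> c * d u0 v0))"
proof (intro conjI exI[of _ "1 / 6 :: real"] allI impI)
  show "infinite (marked_geodesics \<iota>)"
    using completion by (rule infinite_marked_geodesics)
next
  fix u0 v0
  assume "\<exists>G\<in>marked_geodesics \<iota>. u0 \<in> G \<and> v0 \<in> G"
  then obtain \<gamma> i a b where \<gamma>i: "stage_geodesic i \<gamma>" and ab: "a \<in> {0..1}" "b \<in> {0..1}"
    and uv0: "u0 = \<iota> (\<gamma> a)" "v0 = \<iota> (\<gamma> b)"
    unfolding marked_geodesics_eq by blast
  note dist = completion_dist_geodesic[OF completion]
  note listed = listed_in_order_marked[OF completion, folded u v]
  show "\<exists>n\<ge>1. \<exists>w z z'.
         w 0 = u0 \<and> w n = v0 \<and>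
         (\<exists>G\<in>marked_geodesics \<iota>. listed_in_order M d u v G (map w [0..<Suc n])) \<and>
         (\<exists>G\<in>marked_geodesics \<iota>. listed_in_order M d u v G (interleave n w z)) \<and>
         (\<exists>G\<in>marked_geodesics \<iota>. listed_in_order M d u v G (interleave n w z')) \<and>
         (\<forall>i\<in>{1..n}. d (w i) (z i) = d (w i) (z' i) \<and>
                     d (w (i - 1)) (z i) = d (w (i - 1)) (z' i)) \<and>
         (\<Sum>i=1..n. d (z i) (z' i)) \<ge> 1 / 6 * d u0 v0"
  proof (cases "a = b")
    case True
    \<comment> \<open>Here \<open>n = 1\<close> with all points equal to \<open>u0\<close> works, as
      both sides of the last inequality vanish.\<close>
    have "d u0 u0 = 0" using dist[OF \<gamma>i ab(1) ab(1)] uv0 by simp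
    moreover have "\<exists>G\<in>marked_geodesics \<iota>. listed_in_order M d u v G [u0, u0]"
      "\<exists>G\<in>marked_geodesics \<iota>. listed_in_order M d u v G [u0, u0, u0]"
      using listed[OF \<gamma>i, of "[a, a]"] listed[OF \<gamma>i, of "[a, a, a]"] ab uv0 by auto
    ultimately show ?thesis
      using True uv0
      by (intro exI[of _ 1] conjI exI[of _ "\<lambda>_. u0"]) (auto simp: interleave_def)
  next
    case False
    define \<delta> where "\<delta> = \<bar>a - b\<bar>"
    have "0 < \<delta>" using False by (simp add: \<delta>_def)
    \<comment> \<open>\<open>j\<close> must be at least \<open>i\<close>, so that
      \<open>\<gamma>\<close> is a geodesic of stage \<open>j\<close>, and so large that the
      subdivision lemma applies; its bound is the source of the 4.\<close>
    obtain k where k: "4 / \<delta> < 3 ^ k" using real_arch_pow[of 3 "4 / \<delta>"] by auto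
    define j where "j = max i k"
    have "(3 :: real) ^ k \<le> 3 ^ j" by (rule power_increasing) (simp_all add: j_def)
    then have "4 / \<delta> < 3 ^ j" using k by linarith
    then have large: "4 \<le> 3 ^ j * \<bar>a - b\<bar>"
      using \<open>0 < \<delta>\<close> by (simp add: field_simps flip: \<delta>_def)
    show ?thesis
    proof (rule subdivision_heights[OF ab large])
      fix T Z :: "nat \<Rightarrow> real" and A I :: "nat set" and R :: "real \<Rightarrow> real \<Rightarrow> bool"
      assume T: "T 0 = a" "T (3 ^ j) = b" and R: "R = (\<le>) \<or> R = (\<ge>)"
        and mono: "\<And>i. i \<in> {1..3 ^ j} \<Longrightarrow> R (T (i - 1)) (Z i) \<and> R (Z i) (T i)"
        and T01: "\<And>i. T i \<in> {0..1} - middle j A" and Z01: "\<And>i. Z i \<in> {0..1}"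
        and I: "I \<subseteq> {1..3 ^ j}" "3 ^ j * \<bar>a - b\<bar> / 2 \<le> real (card I)"
          "\<And>i. i \<in> I \<Longrightarrow> \<exists>m\<in>A. m < 3 ^ j \<and> Z i = (real m + 1 / 2) / 3 ^ j"
      define n :: nat where "n = 3 ^ j"
      define \<gamma>' where "\<gamma>' = flip j A \<circ> \<gamma>"
      have \<gamma>: "stage_geodesic j \<gamma>"
        using \<gamma>i by (rule stage_geodesic_mono) (simp add: j_def)
      have \<gamma>': "stage_geodesic (Suc j) \<gamma>'"
        unfolding \<gamma>'_def using \<gamma> by (rule stage_geodesic_flip)
      \<comment> \<open>The heights \<open>T i\<close> avoid the switched thirds, so both geodesics
        pass through the same points \<open>w i\<close>.\<close>
      have T': "\<gamma>' (T i) = \<gamma> (T i)" for i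
        using T01[of i] height_stage_geodesic[OF \<gamma>, of "T i"] by (simp add: \<gamma>'_def flip_def)
      define w z z' where "w = (\<iota> \<circ> \<gamma>) \<circ> T" and "z = (\<iota> \<circ> \<gamma>) \<circ> Z" and "z' = (\<iota> \<circ> \<gamma>') \<circ> Z"
      have w': "w = (\<iota> \<circ> \<gamma>') \<circ> T" by (auto simp: w_def T')
      have trR: "transp R" "reflp R"
        using R by (auto simp: transp_def reflp_def)
      have sorted: "sorted xs \<or> sorted (rev xs)" if "sorted_wrt R xs" for xs
        using that R by (auto simp: sorted_wrt_rev)
      have sT: "sorted_wrt R (map T [0..<Suc n])"
        using mono unfolding n_def
        by (intro sorted_wrt_interleave_nodes[where w = T and z = Z] trR) auto
      have sTZ: "sorted_wrt R (interleave n T Z)"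
        using mono unfolding n_def
        by (intro sorted_wrt_interleave[where w = T and z = Z, THEN conjunct1] trR) auto
      have TZ01: "set (map T [0..<Suc n]) \<subseteq> {0..1}" "set (interleave n T Z) \<subseteq> {0..1}"
        using T01 Z01 by (auto simp: set_interleave)
      have "map w [0..<Suc n] = map (\<iota> \<circ> \<gamma>) (map T [0..<Suc n])"
        by (simp add: w_def)
      then have 1: "\<exists>G\<in>marked_geodesics \<iota>. listed_in_order M d u v G (map w [0..<Suc n])"
        using listed[OF \<gamma> TZ01(1) sorted[OF sT]] by metis
      have 2: "\<exists>G\<in>marked_geodesics \<iota>. listed_in_order M d u v G (interleave n w z)"
        unfolding w_def z_def interleave_map by (rule listed[OF \<gamma> TZ01(2) sorted[OF sTZ]])
      have 3: "\<exists>G\<in>marked_geodesics \<iota>. listed_in_order M d u v G (interleave n w z')"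
        unfolding w' z'_def interleave_map by (rule listed[OF \<gamma>' TZ01(2) sorted[OF sTZ]])
      \<comment> \<open>Along either geodesic, distance is difference of heights, and
        \<open>z i\<close>, \<open>z' i\<close> have the same height.\<close>
      have 4: "d (w l) (z i) = d (w l) (z' i)" for l i
      proof -
        have "d (w l) (z i) = \<bar>T l - Z i\<bar>"
          using dist[OF \<gamma>, of "T l" "Z i"] T01[of l] Z01[of i] by (simp add: w_def z_def)
        moreover have "d (w l) (z' i) = \<bar>T l - Z i\<bar>"
          using dist[OF \<gamma>', of "T l" "Z i"] T01[of l] Z01[of i] by (simp add: w' z'_def)
        ultimately show ?thesis by simp
      qed
      have dz: "d (z i) (z' i) = laakso_dist (\<gamma> (Z i)) (flip j A (\<gamma> (Z i)))" for i
        using completion_dist[OF completion, of "\<gamma> (Z i)" "Suc j" "\<gamma>' (Z i)"]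
          stage_geodesic_in_stage[OF stage_geodesic_mono[OF \<gamma>] Z01[of i], of "Suc j"]
          stage_geodesic_in_stage[OF \<gamma>' Z01[of i]]
        by (simp add: z_def z'_def \<gamma>'_def)
      have nonneg: "0 \<le> d (z i) (z' i)" for i
        using completion unfolding is_completion_def by (meson Metric_space.nonneg)
      \<comment> \<open>At least \<open>3 ^ j * \<bar>a - b\<bar> / 2\<close> midpoints are moved by
        at least \<open>1 / (3 * 3 ^ j)\<close> each, which gives the constant 1/6.\<close>
      have "1 / 6 * d u0 v0 = 3 ^ j * \<bar>a - b\<bar> / 2 * (1 / (3 * 3 ^ j))"
        using dist[OF \<gamma> ab] by (simp add: uv0)
      also have "\<dots> \<le> real (card I) * (1 / (3 * 3 ^ j))"
        using I(2) by (rule mult_right_mono) simp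
      also have "\<dots> = (\<Sum>i\<in>I. 1 / (3 * 3 ^ j))" by simp
      also have "\<dots> \<le> (\<Sum>i\<in>I. d (z i) (z' i))"
      proof (rule sum_mono)
        fix i assume "i \<in> I"
        then obtain m where "m \<in> A" "m < 3 ^ j" "Z i = (real m + 1 / 2) / 3 ^ j" using I(3) by blast
        then show "1 / (3 * 3 ^ j) \<le> d (z i) (z' i)"
          using laakso_dist_flip_midpoint[OF \<gamma>, of m A] by (simp add: dz)
      qed
      also have "\<dots> \<le> (\<Sum>i=1..n. d (z i) (z' i))"
        using I(1) nonneg by (intro sum_mono2) (auto simp: n_def)
      finally have "1 / 6 * d u0 v0 \<le> (\<Sum>i=1..n. d (z i) (z' i))" .
      then show ?thesis
        using 1 2 3 4 T by (intro exI[of _ n] conjI exI[of _ w] exI[of _ z] exI[of _ z'])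
          (auto simp: n_def w_def uv0)
    qed
  qed
qed simp

end
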